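(* Let $f^{(0)}\in\mathbb{R}^{n\times n}$ be real antisymmetric with $\mathrm{rank}(f^{(0)})=r=n-d$, where $d=\dim\ker(f^{(0)})\ge1$, and let $B\in\mathbb{R}^{n\times k}$. Let $N\in\mathbb{R}^{n\times d}$ have orthonormal columns spanning $\ker(f^{(0)})$, and define $\Gamma=N^{\top}B\in\mathbb{R}^{d\times k}$. Then the matrix $$f^{(m)}=\begin{pmatrix} f^{(0)} & B\\ -B^{\top} & 0\end{pmatrix}$$ satisfies $\det(f^{(m)})=\det(J)\det(R)$, where $J$ is the nonsingular block of $f^{(0)}$ and $R=\begin{pmatrix}0&\Gamma\\-\Gamma^{\top}&M\end{pmatrix}$ for some antisymmetric matrix $M\in\mathbb{R}^{k\times k}$. In particular, if $k=d$ then $$\det\bigl(f^{(m)}\bigr)=\Bigl(\prod_{\ell=1}^{r/2}\mu_\ell^2\Bigr)\det(\Gamma)^2,$$ where $\mu_\ell>0$ are the Pfaffian factors of $f^{(0)}$. Consequently $f^{(m)}$ is nonsingular (i.e. of rank $n+k$) if and only if (i) $k=d=n-r$, and (ii) $\det(\Gamma)\neq0$, i.e. $\mathrm{rank}(\Gamma)=d$.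
   Context: For a real antisymmetric matrix $A\in\mathbb{R}^{n\times n}$ of rank $r$ there is an orthogonal matrix $Q$ such that $Q^{\top}AQ=\mathrm{diag}(J,0)$, where $J\in\mathbb{R}^{r\times r}$ is block diagonal, $J=\bigoplus_{\ell=1}^{r/2}\mu_\ell\begin{pmatrix}0&1\\-1&0\end{pmatrix}$ with $\mu_\ell>0$, and the last $n-r$ columns of $Q$ form an orthonormal basis of $\ker(A)$ (taken to be the columns of $N$ when $A=f^{(0)}$). $J$ is called the nonsingular block of $A$, and the $\mu_\ell$ are called its Pfaffian factors.
   Formalization: The final "nonsingular if and only if" is stated only for k ≤ d, since it fails for k > d (e.g. n = k = 3, d = 1, B = I gives a nonsingular matrix); for all k it is stated that nonsingularity implies rank(Γ) = d. *)

theory Defs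
  imports "Jordan_Normal_Form.DL_Rank" "Jordan_Normal_Form.Matrix_Kernel"
begin

definition antisymmetric_mat :: "nat \<Rightarrow> real mat \<Rightarrow> bool" where
  "antisymmetric_mat n A \<longleftrightarrow> A \<in> carrier_mat n n \<and> A\<^sup>T = - A"

definition orthonormal_kernel_basis :: "nat \<Rightarrow> nat \<Rightarrow> real mat \<Rightarrow> real mat \<Rightarrow> bool" where
  "orthonormal_kernel_basis n d A N \<longleftrightarrow>
     N \<in> carrier_mat n d \<and> N\<^sup>T * N = 1\<^sub>m d \<and> vec_space.col_space n N = mat_kernel A"

text \<open>The \<open>r \<times> r\<close> block \<open>J\<close> for even \<open>r\<close>; only the values \<open>\<mu> l\<close> with
  \<open>l < r div 2\<close> matter.\<close>

definition pfaffian_block :: "nat \<Rightarrow> (nat \<Rightarrow> real) \<Rightarrow> real mat" where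
  "pfaffian_block r \<mu> =
     diag_block_mat (map (\<lambda>l. \<mu> l \<cdot>\<^sub>m mat_of_rows_list 2 [[0, 1], [-1, 0]]) [0..<r div 2])"

text \<open>\<open>Q\<close> brings the antisymmetric \<open>n \<times> n\<close> matrix \<open>A\<close> of rank \<open>r\<close> to the form
  \<open>diag (J, 0)\<close> with Pfaffian factors \<open>\<mu>\<close>, the last \<open>n - r\<close> columns of \<open>Q\<close> being the
  given kernel basis \<open>N\<close>. For odd \<open>r\<close> the dimensions do not match and the predicate is false.\<close>

definition antisymmetric_normal_form ::
  "nat \<Rightarrow> nat \<Rightarrow> real mat \<Rightarrow> real mat \<Rightarrow> real mat \<Rightarrow> (nat \<Rightarrow> real) \<Rightarrow> bool" where
  "antisymmetric_normal_form n r A N Q \<mu> \<longleftrightarrow>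
     Q \<in> carrier_mat n n \<and> Q\<^sup>T * Q = 1\<^sub>m n \<and>
     (\<forall>l < r div 2. 0 < \<mu> l) \<and>
     Q\<^sup>T * A * Q = diag_block_mat [pfaffian_block r \<mu>, 0\<^sub>m (n - r) (n - r)] \<and>
     (\<forall>j < n - r. col Q (r + j) = col N j)"

definition bordered_mat :: "nat \<Rightarrow> real mat \<Rightarrow> real mat \<Rightarrow> real mat" where
  "bordered_mat k A B = four_block_mat A B (- B\<^sup>T) (0\<^sub>m k k)"

definition reduced_mat :: "nat \<Rightarrow> real mat \<Rightarrow> real mat \<Rightarrow> real mat" where
  "reduced_mat d \<Gamma> M = four_block_mat (0\<^sub>m d d) \<Gamma> (- \<Gamma>\<^sup>T) M"

end

(* A complex eigenvector x + iy of a nonsingular real antisymmetric matrix has a purely imaginary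
   eigenvalue, and x, y are orthogonal of equal length; they span an invariant plane on which the
   matrix acts as a scaled rotation by a right angle. Splitting off such planes one after another,
   on the orthogonal complement of the kernel, gives the normal form. Conjugating the bordered
   matrix by diag (Q, 1) with Q = (P | N) isolates J in the upper left corner, and its Schur
   complement is R with M = (P^T B)^T J^(-1) (P^T B). If R is invertible, the first block row
   (0 | Gamma) of R is onto, so Gamma has full row rank d. *)

theory Submission
  imports Defs "Jordan_Normal_Form.Spectral_Radius"
begin

text \<open>Subspaces enter only through matrices with orthonormal columns: invariance is an
  identity such as \<open>A * U = U * (\<omega> \<cdot>\<^sub>m rot)\<close>, and orthogonality is a
  vanishing product. The complement of an invariant subspace is again invariant because
  \<open>X\<^sup>T * A * Y\<close> and \<open>Y\<^sup>T * A * X\<close> are negative transposes of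
  each other, so a vanishing off-diagonal block brings its mirror image with it. The delicate point
  is that a plane can only be split off from a nonsingular matrix. Within the induction,
  nonsingularity is inherited through the multiplicativity of the determinant; at the start it rests
  on the columns of \<open>N\<close> exhausting the kernel, so that the compression to their
  complement has trivial kernel. For \<open>k = d\<close> the block \<open>M\<close> drops out of
  the determinant because \<open>R\<close> is a product of a block triangular matrix and a block
  antidiagonal one.\<close>

section \<open>Matrices side by side and their congruences\<close>

definition hcat :: "'a :: zero mat \<Rightarrow> 'a mat \<Rightarrow> 'a mat" where
  "hcat A B = four_block_mat A B (0\<^sub>m 0 (dim_col A)) (0\<^sub>m 0 (dim_col B))"

lemma hcat_carrier [simp]:
  "A \<in> carrier_mat n a \<Longrightarrow> B \<in> carrier_mat n b \<Longrightarrow> hcat A B \<in> carrier_mat n (a + b)"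
  unfolding hcat_def by (metis four_block_carrier_mat Nat.add_0_right carrier_matD(2) zero_carrier_mat)

lemma dim_hcat [simp]:
  "dim_row (hcat A B) = dim_row A" "dim_col (hcat A B) = dim_col A + dim_col B"
  by (simp_all add: hcat_def)

lemma index_hcat:
  assumes "A \<in> carrier_mat n a" "B \<in> carrier_mat n b" "i < n" "j < a + b"
  shows "hcat A B $$ (i, j) = (if j < a then A $$ (i, j) else B $$ (i, j - a))"
  using assms by (auto simp: hcat_def)

lemma col_hcat:
  assumes "A \<in> carrier_mat n a" "B \<in> carrier_mat n b" "j < a + b"
  shows "col (hcat A B) j = (if j < a then col A j else col B (j - a))"
  using assms by (intro eq_vecI) (auto simp: index_hcat[of A n a B b])

lemma mult_hcat:
  assumes "X \<in> carrier_mat m n" "A \<in> carrier_mat n a" "B \<in> carrier_mat n b"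
  shows "X * hcat A B = hcat (X * A) (X * B)"
  using assms
  by (intro eq_matI)
     (auto simp: index_hcat[of "X * A" m a "X * B" b] col_hcat[of A n a B b])

lemma transpose_hcat_mult:
  assumes "A \<in> carrier_mat n a" "B \<in> carrier_mat n b" "C \<in> carrier_mat n c" "D \<in> carrier_mat n e"
  shows "(hcat A B)\<^sup>T * hcat C D = four_block_mat (A\<^sup>T * C) (A\<^sup>T * D) (B\<^sup>T * C) (B\<^sup>T * D)"
  using assms
  by (intro eq_matI) (auto simp: col_hcat[of A n a B b] col_hcat[of C n c D e])

lemma congruence_hcat:
  assumes "M \<in> carrier_mat n n" "A \<in> carrier_mat n a" "B \<in> carrier_mat n b"
  shows "(hcat A B)\<^sup>T * M * hcat A B =
    four_block_mat (A\<^sup>T * M * A) (A\<^sup>T * M * B) (B\<^sup>T * M * A) (B\<^sup>T * M * B)"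
proof -
  have "(hcat A B)\<^sup>T * M * hcat A B = (hcat A B)\<^sup>T * (M * hcat A B)"
    using assms by (intro assoc_mult_mat[of _ "a + b" n _ n _ "a + b"]) auto
  also have "\<dots> = (hcat A B)\<^sup>T * hcat (M * A) (M * B)"
    by (simp add: mult_hcat[OF assms])
  also have "\<dots> = four_block_mat (A\<^sup>T * (M * A)) (A\<^sup>T * (M * B)) (B\<^sup>T * (M * A)) (B\<^sup>T * (M * B))"
    using assms by (intro transpose_hcat_mult) auto
  finally show ?thesis
    using assms by (simp add: assoc_mult_mat[of _ _ n _ n])
qed

lemma transpose_mult_zero:
  fixes A B :: "'a :: comm_semiring_0 mat"
  assumes "A \<in> carrier_mat n a" "B \<in> carrier_mat n b" "A\<^sup>T * B = 0\<^sub>m a b"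
  shows "B\<^sup>T * A = 0\<^sub>m b a"
  using assms transpose_mult[of "A\<^sup>T" a n B b] by simp

section \<open>Completing orthonormal columns\<close>

lemma scalar_prod_self_pos:
  fixes v :: "real vec"
  assumes "v \<in> carrier_vec n" "v \<noteq> 0\<^sub>v n"
  shows "v \<bullet> v > 0"
proof -
  obtain i where "i < n" "v $ i \<noteq> 0"
    using assms by (metis carrier_vecD eq_vecI index_zero_vec)
  thus ?thesis
    using assms unfolding scalar_prod_def
    by (intro sum_pos2[of _ i]) (auto simp: zero_less_mult_iff)
qed

text \<open>Padding with zero rows gives a square matrix whose last row vanishes, hence of
  determinant 0; a kernel vector of it is then normalised. The vector is delivered as a one-column
  matrix so that it can be appended with \<open>hcat\<close>.\<close>

lemma wide_mat_unit_kernel: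
  fixes A :: "real mat"
  assumes A: "A \<in> carrier_mat m n" and "m < n"
  shows "\<exists>W \<in> carrier_mat n 1. W\<^sup>T * W = 1\<^sub>m 1 \<and> A * W = 0\<^sub>m m 1"
proof -
  define C where "C = mat n n (\<lambda>(i, j). if i < m then A $$ (i, j) else 0)"
  have C: "C \<in> carrier_mat n n" by (simp add: C_def)
  have "row C (n - 1) = 0\<^sub>v n"
    using \<open>m < n\<close> by (intro eq_vecI) (auto simp: C_def)
  hence "C\<^sup>T *\<^sub>v unit_vec n (n - 1) = 0\<^sub>v n"
    using \<open>m < n\<close> C by (intro eq_vecI) (auto simp: C_def)
  moreover have "unit_vec n (n - 1) \<noteq> (0\<^sub>v n :: real vec)"
    using \<open>m < n\<close> by (intro unit_vec_nonzero) auto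
  ultimately have "det (C\<^sup>T) = 0"
    using C det_0_iff_vec_prod_zero[of "C\<^sup>T" n] by (metis transpose_carrier_mat unit_vec_carrier)
  hence "det C = 0" using C det_transpose by metis
  then obtain v where v: "v \<in> carrier_vec n" "v \<noteq> 0\<^sub>v n" "C *\<^sub>v v = 0\<^sub>v n"
    using det_0_iff_vec_prod_zero[OF C] by auto
  have row: "row A i \<bullet> v = 0" if "i < m" for i
  proof -
    have "row A i = row C i"
      using that A \<open>m < n\<close> by (intro eq_vecI) (auto simp: C_def)
    moreover have "row C i \<bullet> v = (C *\<^sub>v v) $ i"
      using that C \<open>m < n\<close> by simp
    ultimately show ?thesis using v that \<open>m < n\<close> by simp
  qed
  define c where "c = 1 / sqrt (v \<bullet> v)"
  define w where "w = c \<cdot>\<^sub>v v"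
  have c: "c * c * (v \<bullet> v) = 1"
    using scalar_prod_self_pos[OF v(1,2)] by (simp add: c_def)
  have w: "w \<in> carrier_vec n" "w \<bullet> w = 1"
    using v c by (auto simp: w_def mult_ac)
  have roww: "row A i \<bullet> w = 0" if "i < m" for i
    using row[OF that] v A that by (simp add: w_def)
  define W where "W = mat_of_cols n [w]"
  have W: "W \<in> carrier_mat n 1" "col W 0 = w"
    using w by (auto simp: W_def)
  have "W\<^sup>T * W = 1\<^sub>m 1"
    using W w by (intro eq_matI) auto
  moreover have "A * W = 0\<^sub>m m 1"
    using W A roww by (intro eq_matI) auto
  ultimately show ?thesis using W by blast
qed

text \<open>If \<open>d > n\<close>, then \<open>N\<close> kills a unit column \<open>W\<close>, but
  \<open>N\<^sup>T * N * W = W\<close>.\<close>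

lemma orthonormal_dim_le:
  fixes N :: "real mat"
  assumes N: "N \<in> carrier_mat n d" and "N\<^sup>T * N = 1\<^sub>m d"
  shows "d \<le> n"
proof (rule ccontr)
  assume "\<not> d \<le> n"
  then obtain W where W: "W \<in> carrier_mat d 1" "W\<^sup>T * W = 1\<^sub>m 1" "N * W = 0\<^sub>m n 1"
    using wide_mat_unit_kernel[OF N] by auto
  have "W = N\<^sup>T * N * W" using W assms by simp
  also have "\<dots> = N\<^sup>T * (N * W)" using N W by (intro assoc_mult_mat) auto
  also have "\<dots> = 0\<^sub>m d 1" using N W by simp
  finally have "W = 0\<^sub>m d 1" .
  hence "W\<^sup>T * W = 0\<^sub>m 1 1" by simp
  with W(2) show False by (metis index_one_mat(1) index_zero_mat(1) less_one zero_neq_one)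
qed

text \<open>Induction on the number of missing columns: a unit vector killed by
  \<open>N\<^sup>T\<close> is orthogonal to all columns of \<open>N\<close> and is appended to
  them.\<close>

lemma orthonormal_completion:
  fixes N :: "real mat"
  assumes "N \<in> carrier_mat n d" "N\<^sup>T * N = 1\<^sub>m d"
  shows "\<exists>P \<in> carrier_mat n (n - d). P\<^sup>T * P = 1\<^sub>m (n - d) \<and> P\<^sup>T * N = 0\<^sub>m (n - d) d"
  using assms
proof (induction "n - d" arbitrary: N d)
  case 0
  hence "n = d" using orthonormal_dim_le[of N n d] by simp
  thus ?case using 0 by (intro bexI[of _ "0\<^sub>m n 0"]) (auto intro!: eq_matI)
next
  case (Suc s)
  note N = Suc.prems
  have "d < n" using Suc.hyps(2) by simp
  then obtain W where W: "W \<in> carrier_mat n 1" "W\<^sup>T * W = 1\<^sub>m 1" "N\<^sup>T * W = 0\<^sub>m d 1"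
    using wide_mat_unit_kernel[of "N\<^sup>T" d n] N by auto
  have WN: "W\<^sup>T * N = 0\<^sub>m 1 d"
    by (rule transpose_mult_zero[OF N(1) W(1,3)])
  have "(hcat N W)\<^sup>T * hcat N W = 1\<^sub>m (d + 1)"
    using N W WN by (simp add: transpose_hcat_mult[of _ n d _ 1 _ d _ 1])
  moreover have "s = n - (d + 1)" using Suc.hyps(2) by simp
  ultimately obtain P where P: "P \<in> carrier_mat n s" "P\<^sup>T * P = 1\<^sub>m s"
    "P\<^sup>T * hcat N W = 0\<^sub>m s (d + 1)"
    using Suc.hyps(1)[OF _ hcat_carrier[OF N(1) W(1)]] by metis
  \<comment> \<open>The single orthogonality relation with \<open>hcat N W\<close> is split by
    columns: those below \<open>d\<close> concern \<open>N\<close>, column \<open>d\<close> concerns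
    \<open>W\<close>.\<close>
  have h: "hcat (P\<^sup>T * N) (P\<^sup>T * W) = 0\<^sub>m s (d + 1)"
    using P N W by (simp add: mult_hcat[of _ s n, symmetric])
  have PN: "P\<^sup>T * N = 0\<^sub>m s d"
  proof (rule eq_matI)
    fix i j assume "i < dim_row (0\<^sub>m s d)" "j < dim_col (0\<^sub>m s d)"
    thus "(P\<^sup>T * N) $$ (i, j) = 0\<^sub>m s d $$ (i, j)"
      using arg_cong[OF h, of "\<lambda>M. M $$ (i, j)"] P N W
      by (simp add: index_hcat[of "P\<^sup>T * N" s d "P\<^sup>T * W" 1] del: index_mult_mat)
  qed (use P N in auto)
  have PW: "P\<^sup>T * W = 0\<^sub>m s 1"
  proof (rule eq_matI)
    fix i j assume "i < dim_row (0\<^sub>m s 1)" "j < dim_col (0\<^sub>m s 1)"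
    thus "(P\<^sup>T * W) $$ (i, j) = 0\<^sub>m s 1 $$ (i, j)"
      using arg_cong[OF h, of "\<lambda>M. M $$ (i, d + j)"] P N W
      by (simp add: index_hcat[of "P\<^sup>T * N" s d "P\<^sup>T * W" 1] del: index_mult_mat)
  qed (use P W in auto)
  have WP: "W\<^sup>T * P = 0\<^sub>m 1 s"
    by (rule transpose_mult_zero[OF P(1) W(1) PW])
  have nd: "n - d = 1 + s" using Suc.hyps(2) by simp
  show ?case
  proof (intro bexI conjI)
    show "hcat W P \<in> carrier_mat n (n - d)" unfolding nd by (rule hcat_carrier[OF W(1) P(1)])
    show "(hcat W P)\<^sup>T * hcat W P = 1\<^sub>m (n - d)"
      unfolding nd using P W PW WP by (simp add: transpose_hcat_mult[of _ n 1 _ s _ 1 _ s])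
    have "N\<^sup>T * P = 0\<^sub>m d s"
      by (rule transpose_mult_zero[OF P(1) N(1) PN])
    hence "N\<^sup>T * hcat W P = 0\<^sub>m d (1 + s)"
      using P W N by (simp add: mult_hcat[of _ d n _ 1 _ s]) (auto simp: index_hcat[of _ d 1 _ s])
    thus "(hcat W P)\<^sup>T * N = 0\<^sub>m (n - d) d"
      unfolding nd using P W N by (intro transpose_mult_zero[of N n d]) auto
  qed
qed

section \<open>Rotation planes of antisymmetric matrices\<close>

abbreviation (input) rot :: "real mat" where
  "rot \<equiv> mat_of_rows_list 2 [[0, 1], [-1, 0]]"

lemma rot_carrier: "rot \<in> carrier_mat 2 2"
  by (simp add: mat_of_rows_list_def carrier_matI)

text \<open>For \<open>x = y\<close> this makes \<open>x \<bullet> (A *\<^sub>v x)\<close> vanish,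
  which excludes a real part of the eigenvalue; for \<open>x \<noteq> y\<close> it compares the
  lengths of the two parts of an eigenvector.\<close>

lemma antisymmetric_scalar_prod:
  assumes A: "antisymmetric_mat n A" and x: "x \<in> carrier_vec n" and y: "y \<in> carrier_vec n"
  shows "x \<bullet> (A *\<^sub>v y) = - (y \<bullet> (A *\<^sub>v x))"
proof -
  have A': "A \<in> carrier_mat n n" "A\<^sup>T = - A" using A by (auto simp: antisymmetric_mat_def)
  have "x \<bullet> (A *\<^sub>v y) = (A\<^sup>T *\<^sub>v x) \<bullet> y"
    using transpose_vec_mult_scalar[OF A'(1) y x] by simp
  also have "\<dots> = - ((A *\<^sub>v x) \<bullet> y)"
    using A' x y by simp
  also have "(A *\<^sub>v x) \<bullet> y = y \<bullet> (A *\<^sub>v x)"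
    using A' x y by (intro comm_scalar_prod) auto
  finally show ?thesis .
qed

text \<open>As \<open>A\<close> is real, the real and imaginary parts of the equation for the
  eigenvector \<open>x + iy\<close> with eigenvalue \<open>a + ib\<close> separate. One of
  \<open>x\<close> and \<open>y\<close> may vanish at this stage.\<close>

lemma complex_eigenvector_Re_Im:
  fixes A :: "real mat"
  assumes A: "A \<in> carrier_mat n n" and "n > 0"
  shows "\<exists>x y a b. x \<in> carrier_vec n \<and> y \<in> carrier_vec n \<and> (x \<noteq> 0\<^sub>v n \<or> y \<noteq> 0\<^sub>v n) \<and>
    A *\<^sub>v x = a \<cdot>\<^sub>v x - b \<cdot>\<^sub>v y \<and> A *\<^sub>v y = b \<cdot>\<^sub>v x + a \<cdot>\<^sub>v y"
proof -
  let ?A = "map_mat complex_of_real A"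
  have "spectrum ?A \<noteq> {}"
    using assms by (intro spectrum_non_empty[of _ n]) auto
  then obtain k z where "eigenvector ?A z k"
    by (auto simp: spectrum_def eigenvalue_def)
  hence z: "z \<in> carrier_vec n" "z \<noteq> 0\<^sub>v n" "?A *\<^sub>v z = k \<cdot>\<^sub>v z"
    using A by (auto simp: eigenvector_def)
  have entry: "(\<Sum>j = 0..<n. complex_of_real (A $$ (i, j)) * z $ j) = k * z $ i" if "i < n" for i
    using arg_cong[OF z(3), of "\<lambda>v. v $ i"] that A z(1) by (simp add: scalar_prod_def)
  define x where "x = map_vec Re z"
  define y where "y = map_vec Im z"
  have xy: "x \<in> carrier_vec n" "y \<in> carrier_vec n"
    using z by (auto simp: x_def y_def)
  have "x \<noteq> 0\<^sub>v n \<or> y \<noteq> 0\<^sub>v n"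
  proof (rule ccontr)
    assume "\<not> ?thesis"
    hence "x $ i = 0" "y $ i = 0" if "i < n" for i using that by auto
    hence "z = 0\<^sub>v n"
      using z(1) by (intro eq_vecI) (auto simp: x_def y_def complex_eq_iff)
    thus False using z(2) by simp
  qed
  moreover have "A *\<^sub>v x = Re k \<cdot>\<^sub>v x - Im k \<cdot>\<^sub>v y"
  proof (rule eq_vecI)
    fix i assume "i < dim_vec (Re k \<cdot>\<^sub>v x - Im k \<cdot>\<^sub>v y)"
    hence i: "i < n" using xy by auto
    have "(A *\<^sub>v x) $ i = Re (\<Sum>j = 0..<n. complex_of_real (A $$ (i, j)) * z $ j)"
      using i A z(1) by (simp add: scalar_prod_def x_def)
    thus "(A *\<^sub>v x) $ i = (Re k \<cdot>\<^sub>v x - Im k \<cdot>\<^sub>v y) $ i"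
      unfolding entry[OF i] using i z(1) by (simp add: x_def y_def)
  qed (use A xy in auto)
  moreover have "A *\<^sub>v y = Im k \<cdot>\<^sub>v x + Re k \<cdot>\<^sub>v y"
  proof (rule eq_vecI)
    fix i assume "i < dim_vec (Im k \<cdot>\<^sub>v x + Re k \<cdot>\<^sub>v y)"
    hence i: "i < n" using xy by auto
    have "(A *\<^sub>v y) $ i = Im (\<Sum>j = 0..<n. complex_of_real (A $$ (i, j)) * z $ j)"
      using i A z(1) by (simp add: scalar_prod_def y_def)
    thus "(A *\<^sub>v y) $ i = (Im k \<cdot>\<^sub>v x + Re k \<cdot>\<^sub>v y) $ i"
      unfolding entry[OF i] using i z(1) by (simp add: x_def y_def)
  qed (use A xy in auto)
  ultimately show ?thesis using xy by blast
qed

lemma antisymmetric_rotation_plane: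
  assumes A: "antisymmetric_mat n A" and "det A \<noteq> 0" and "n > 0"
  shows "\<exists>U \<omega>. U \<in> carrier_mat n 2 \<and> U\<^sup>T * U = 1\<^sub>m 2 \<and> 0 < \<omega> \<and> A * U = U * (\<omega> \<cdot>\<^sub>m rot)"
proof -
  have AA: "A \<in> carrier_mat n n" using A by (auto simp: antisymmetric_mat_def)
  obtain x y a b where x: "x \<in> carrier_vec n" and y: "y \<in> carrier_vec n"
    and xy0: "x \<noteq> 0\<^sub>v n \<or> y \<noteq> 0\<^sub>v n"
    and Ax: "A *\<^sub>v x = a \<cdot>\<^sub>v x - b \<cdot>\<^sub>v y" and Ay: "A *\<^sub>v y = b \<cdot>\<^sub>v x + a \<cdot>\<^sub>v y"
    using complex_eigenvector_Re_Im[OF AA \<open>n > 0\<close>] by blast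
  have yx: "y \<bullet> x = x \<bullet> y" by (rule comm_scalar_prod[OF y x])
  have nonneg: "v \<bullet> v \<ge> 0" if "v \<in> carrier_vec n" for v :: "real vec"
    using that by (auto simp: scalar_prod_def intro!: sum_nonneg)
  have pos: "x \<bullet> x + y \<bullet> y > 0"
    using xy0 scalar_prod_self_pos[OF x] scalar_prod_self_pos[OF y] nonneg[OF x] nonneg[OF y]
    by auto
  have xAx: "a * (x \<bullet> x) - b * (x \<bullet> y) = 0"
    using antisymmetric_scalar_prod[OF A x x] x y
    by (simp add: Ax scalar_prod_minus_distrib[of x n])
  have yAy: "b * (x \<bullet> y) + a * (y \<bullet> y) = 0"
    using antisymmetric_scalar_prod[OF A y y] x y
    by (simp add: Ay scalar_prod_add_distrib[of y n] yx)
  \<comment> \<open>The mixed terms \<open>b * (x \<bullet> y)\<close> cancel in the sum of the two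
    relations.\<close>
  have "a * (x \<bullet> x + y \<bullet> y) = 0"
    using xAx yAy by (simp add: algebra_simps)
  hence a: "a = 0" using pos by auto
  \<comment> \<open>With \<open>a = 0\<close>, a vanishing \<open>b\<close> would put both
    \<open>x\<close> and \<open>y\<close> into the kernel of the nonsingular
    \<open>A\<close>.\<close>
  have b: "b \<noteq> 0"
  proof
    assume "b = 0"
    hence "A *\<^sub>v x = 0\<^sub>v n" "A *\<^sub>v y = 0\<^sub>v n"
      using Ax Ay a x y by auto
    thus False
      using xy0 x y \<open>det A \<noteq> 0\<close> det_0_iff_vec_prod_zero[OF AA] by blast
  qed
  have xy: "x \<bullet> y = 0" using xAx a b by simp
  have "x \<bullet> x = y \<bullet> y"
    using antisymmetric_scalar_prod[OF A x y] x y a b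
    by (simp add: Ax Ay scalar_prod_add_distrib[of x n] scalar_prod_minus_distrib[of y n] xy yx)
  hence xx: "x \<bullet> x > 0" "y \<bullet> y = x \<bullet> x" using pos by auto
  define c where "c = 1 / sqrt (x \<bullet> x)"
  have c: "c * c * (x \<bullet> x) = 1" using xx by (simp add: c_def)
  define u where "u = c \<cdot>\<^sub>v x"
  \<comment> \<open>The sign of \<open>b\<close> is absorbed into the second vector, so that the
    factor of the rotation becomes \<open>\<bar>b\<bar> > 0\<close>.\<close>
  define v where "v = (c * sgn b) \<cdot>\<^sub>v y"
  have uv: "u \<in> carrier_vec n" "v \<in> carrier_vec n" using x y by (auto simp: u_def v_def)
  have "sgn b * sgn b = 1" using b by (simp add: sgn_if)
  hence "c * sgn b * (c * sgn b * (x \<bullet> x)) = 1" using c by (metis mult.assoc mult.commute mult_1)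
  hence prods: "u \<bullet> u = 1" "v \<bullet> v = 1" "u \<bullet> v = 0" "v \<bullet> u = 0"
    using c x y xx xy yx by (auto simp: u_def v_def mult.assoc)
  have Au: "A *\<^sub>v u = - \<bar>b\<bar> \<cdot>\<^sub>v v"
  proof -
    have "A *\<^sub>v u = c \<cdot>\<^sub>v (A *\<^sub>v x)" using AA x by (simp add: u_def mult_mat_vec)
    also have "\<dots> = - \<bar>b\<bar> \<cdot>\<^sub>v v"
      using x y by (intro eq_vecI) (auto simp: Ax a v_def sgn_if abs_if)
    finally show ?thesis .
  qed
  have Av: "A *\<^sub>v v = \<bar>b\<bar> \<cdot>\<^sub>v u"
  proof -
    have "A *\<^sub>v v = (c * sgn b) \<cdot>\<^sub>v (A *\<^sub>v y)" using AA y by (simp add: v_def mult_mat_vec)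
    also have "\<dots> = \<bar>b\<bar> \<cdot>\<^sub>v u"
      using x y by (intro eq_vecI) (auto simp: Ay a u_def abs_sgn mult_ac)
    finally show ?thesis .
  qed
  define U where "U = mat_of_cols n [u, v]"
  have U: "U \<in> carrier_mat n 2" by (intro carrier_matI) (auto simp: U_def)
  have cols: "col U 0 = u" "col U (Suc 0) = v" using uv by (auto simp: U_def)
  have "U\<^sup>T * U = 1\<^sub>m 2"
    using U cols prods by (intro eq_matI) (auto simp: less_2_cases_iff)
  moreover have "A * U = U * (\<bar>b\<bar> \<cdot>\<^sub>m rot)"
  proof (rule eq_matI)
    fix i j assume "i < dim_row (U * (\<bar>b\<bar> \<cdot>\<^sub>m rot))" "j < dim_col (U * (\<bar>b\<bar> \<cdot>\<^sub>m rot))"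
    hence i: "i < n" and j: "j = 0 \<or> j = 1" using U by (auto simp: mat_of_rows_list_def less_2_cases_iff)
    have ui: "U $$ (i, 0) = u $ i" "U $$ (i, Suc 0) = v $ i"
      using i by (auto simp: U_def mat_of_cols_index)
    have "(A * U) $$ (i, j) = (A *\<^sub>v col U j) $ i"
      using i j U AA by auto
    moreover have "(U * (\<bar>b\<bar> \<cdot>\<^sub>m rot)) $$ (i, j) = (if j = 0 then - \<bar>b\<bar> * v $ i else \<bar>b\<bar> * u $ i)"
      using i j U ui by (auto simp: scalar_prod_def mat_of_rows_list_def numeral_2_eq_2)
    ultimately show "(A * U) $$ (i, j) = (U * (\<bar>b\<bar> \<cdot>\<^sub>m rot)) $$ (i, j)"
      using i j uv by (auto simp: cols Au Av)
  qed (use U AA in \<open>auto simp: mat_of_rows_list_def\<close>)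
  ultimately show ?thesis using U b by (intro exI[of _ U] exI[of _ "\<bar>b\<bar>"]) auto
qed

section \<open>Shape and determinant of the Pfaffian block\<close>

text \<open>For odd \<open>r\<close> the size is \<open>r - 1\<close>; this mismatch is what later
  forces the rank in a normal form to be even.\<close>

lemma pfaffian_block_carrier:
  "pfaffian_block r \<mu> \<in> carrier_mat (2 * (r div 2)) (2 * (r div 2))"
  by (intro carrier_matI)
     (auto simp: pfaffian_block_def dim_diag_block_mat comp_def mat_of_rows_list_def
        sum_list_triv mult.commute)

text \<open>Mirrors the splitting off of one plane: its factor comes first and the remaining factors
  are shifted by one index.\<close>

lemma pfaffian_block_add_2:
  "pfaffian_block (r + 2) \<mu> = four_block_mat (\<mu> 0 \<cdot>\<^sub>m rot) (0\<^sub>m 2 (2 * (r div 2)))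
     (0\<^sub>m (2 * (r div 2)) 2) (pfaffian_block r (\<lambda>l. \<mu> (Suc l)))"
proof -
  have "[0..<(r + 2) div 2] = 0 # map Suc [0..<r div 2]"
    by (simp add: upt_conv_Cons map_Suc_upt del: upt_Suc)
  thus ?thesis
    using pfaffian_block_carrier[of r "\<lambda>l. \<mu> (Suc l)"]
    by (simp add: pfaffian_block_def Let_def comp_def rot_carrier[THEN carrier_matD(1)]
        rot_carrier[THEN carrier_matD(2)])
qed

lemma det_rot: "det rot = 1"
  using laplace_expansion_row[OF rot_carrier, of 0]
  by (simp add: mat_of_rows_list_def numeral_2_eq_2 cofactor_def det_single mat_delete_def)

lemma det_pfaffian_block: "det (pfaffian_block r \<mu>) = (\<Prod>l<r div 2. (\<mu> l)\<^sup>2)"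
proof (induction "r div 2" arbitrary: r \<mu>)
  case 0
  thus ?case by (simp add: pfaffian_block_def)
next
  case (Suc m)
  hence r: "r = (r - 2) + 2" "(r - 2) div 2 = m" by auto
  have "det (pfaffian_block r \<mu>) = det (\<mu> 0 \<cdot>\<^sub>m rot) * det (pfaffian_block (r - 2) (\<lambda>l. \<mu> (Suc l)))"
    using pfaffian_block_carrier[of "r - 2"]
    by (subst r(1), subst pfaffian_block_add_2)
       (intro det_four_block_mat_lower_left_zero[of _ 2 _ "2 * ((r - 2) div 2)"],
        auto simp: mat_of_rows_list_def)
  also have "\<dots> = (\<mu> 0)\<^sup>2 * (\<Prod>l<m. (\<mu> (Suc l))\<^sup>2)"
    using Suc.hyps(1)[of "r - 2"] r(2) rot_carrier by (simp add: det_rot)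
  also have "\<dots> = (\<Prod>l<r div 2. (\<mu> l)\<^sup>2)"
    unfolding Suc.hyps(2)[symmetric] by (subst prod.lessThan_Suc_shift) simp
  finally show ?case .
qed

section \<open>Congruences and the nonsingular normal form\<close>

lemma zero_mat_mult_vec:
  "v \<in> carrier_vec n \<Longrightarrow> 0\<^sub>m m n *\<^sub>v v = (0\<^sub>v m :: 'a :: semiring_0 vec)"
  by (intro eq_vecI) auto

lemma mult_mat_zero_vec:
  "A \<in> carrier_mat m n \<Longrightarrow> A *\<^sub>v 0\<^sub>v n = (0\<^sub>v m :: 'a :: semiring_0 vec)"
  by (intro eq_vecI) (auto simp: scalar_prod_def)

text \<open>With different \<open>X\<close> and \<open>Y\<close> this transfers the vanishing of one
  off-diagonal block to the opposite one; with \<open>X = Y\<close> it shows that compressions stay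
  antisymmetric.\<close>

lemma antisymmetric_congruence_transpose:
  assumes A: "antisymmetric_mat n A" and X: "X \<in> carrier_mat n a" and Y: "Y \<in> carrier_mat n b"
  shows "(X\<^sup>T * A * Y)\<^sup>T = - (Y\<^sup>T * A * X)"
proof -
  have A': "A \<in> carrier_mat n n" "A\<^sup>T = - A" using A by (auto simp: antisymmetric_mat_def)
  have "(X\<^sup>T * A * Y)\<^sup>T = Y\<^sup>T * (A\<^sup>T * X)"
    using A'(1) X Y by (simp add: transpose_mult[of _ a n _ b] transpose_mult[OF A'(1) Y])
  also have "\<dots> = - (Y\<^sup>T * A * X)"
    using A' X Y by (simp add: assoc_mult_mat[of _ b n _ n _ a])
  finally show ?thesis .
qed

lemma antisymmetric_congruence:
  assumes "antisymmetric_mat n A" "X \<in> carrier_mat n a"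
  shows "antisymmetric_mat a (X\<^sup>T * A * X)"
  using assms antisymmetric_congruence_transpose[OF assms(1,2,2)] by (auto simp: antisymmetric_mat_def)

lemma congruence_mult:
  fixes M :: "'a :: comm_ring_1 mat"
  assumes M: "M \<in> carrier_mat n n" and X: "X \<in> carrier_mat n a" and R: "R \<in> carrier_mat a a'"
    and Y: "Y \<in> carrier_mat n b" and S: "S \<in> carrier_mat b b'"
  shows "(X * R)\<^sup>T * M * (Y * S) = R\<^sup>T * (X\<^sup>T * M * Y) * S"
proof -
  have "(X * R)\<^sup>T * M * (Y * S) = R\<^sup>T * X\<^sup>T * M * Y * S"
    using assms by (simp add: transpose_mult[OF X R] assoc_mult_mat[of _ a' n Y b S b'])
  also have "R\<^sup>T * X\<^sup>T * M * Y = R\<^sup>T * (X\<^sup>T * M * Y)"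
    using assms by (simp add: assoc_mult_mat[of _ a' a _ n _ n] assoc_mult_mat[of _ a' a _ n _ b])
  finally show ?thesis .
qed

text \<open>\<open>X\<close> and \<open>Y\<close> span decoupled subspaces, and \<open>R\<close> and
  \<open>S\<close> change the basis inside each of them. The matrix \<open>M\<close> is either the
  antisymmetric matrix itself or the identity, the latter yielding orthonormality.\<close>

lemma congruence_hcat_mult:
  fixes M :: "'a :: comm_ring_1 mat"
  assumes M: "M \<in> carrier_mat n n" and X: "X \<in> carrier_mat n a" and R: "R \<in> carrier_mat a a"
    and Y: "Y \<in> carrier_mat n b" and S: "S \<in> carrier_mat b b"
    and "X\<^sup>T * M * Y = 0\<^sub>m a b" "Y\<^sup>T * M * X = 0\<^sub>m b a"
  shows "(hcat (X * R) (Y * S))\<^sup>T * M * hcat (X * R) (Y * S) =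
    four_block_mat (R\<^sup>T * (X\<^sup>T * M * X) * R) (0\<^sub>m a b) (0\<^sub>m b a) (S\<^sup>T * (Y\<^sup>T * M * Y) * S)"
proof -
  have XR: "X * R \<in> carrier_mat n a" and YS: "Y * S \<in> carrier_mat n b"
    using X R Y S by auto
  show ?thesis
    unfolding congruence_hcat[OF M XR YS] congruence_mult[OF M X R Y S] congruence_mult[OF M X R X R]
      congruence_mult[OF M Y S Y S] congruence_mult[OF M Y S X R] assms(6,7)
    using R S by simp
qed

lemma hcat_mult_orthonormal:
  fixes X Y :: "'a :: comm_ring_1 mat"
  assumes X: "X \<in> carrier_mat n a" and R: "R \<in> carrier_mat a a"
    and Y: "Y \<in> carrier_mat n b" and S: "S \<in> carrier_mat b b"
    and "X\<^sup>T * X = 1\<^sub>m a" "R\<^sup>T * R = 1\<^sub>m a" "Y\<^sup>T * Y = 1\<^sub>m b" "S\<^sup>T * S = 1\<^sub>m b" "Y\<^sup>T * X = 0\<^sub>m b a"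
  shows "(hcat (X * R) (Y * S))\<^sup>T * hcat (X * R) (Y * S) = 1\<^sub>m (a + b)"
proof -
  have "X\<^sup>T * Y = 0\<^sub>m a b" by (rule transpose_mult_zero[OF Y X assms(9)])
  hence "(hcat (X * R) (Y * S))\<^sup>T * 1\<^sub>m n * hcat (X * R) (Y * S) =
      four_block_mat (R\<^sup>T * (X\<^sup>T * 1\<^sub>m n * X) * R) (0\<^sub>m a b) (0\<^sub>m b a) (S\<^sup>T * (Y\<^sup>T * 1\<^sub>m n * Y) * S)"
    using assms by (intro congruence_hcat_mult) auto
  thus ?thesis using assms by simp
qed

text \<open>Each plane lowers the dimension by 2 and leaves a nonsingular antisymmetric compression,
  so the evenness of \<open>n\<close> comes out of the same induction. Positivity is claimed at
  every index, so that the shift of the factors needs no bounds.\<close>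

lemma antisymmetric_nonsingular_normal_form:
  assumes "antisymmetric_mat n A" "det A \<noteq> 0"
  shows "even n \<and> (\<exists>Q \<mu>. Q \<in> carrier_mat n n \<and> Q\<^sup>T * Q = 1\<^sub>m n \<and> (\<forall>l. 0 < \<mu> l) \<and>
    Q\<^sup>T * A * Q = pfaffian_block n \<mu>)"
  using assms
proof (induction n arbitrary: A rule: less_induct)
  case (less n)
  note A = less.prems(1)
  have AA: "A \<in> carrier_mat n n" using A by (auto simp: antisymmetric_mat_def)
  show ?case
  proof (cases "n = 0")
    case True
    thus ?thesis
      using AA by (auto simp: pfaffian_block_def intro!: exI[of _ "1\<^sub>m 0"] exI[of _ "\<lambda>_. 1"])
  next
    case False
    then obtain U \<omega> where U: "U \<in> carrier_mat n 2" "U\<^sup>T * U = 1\<^sub>m 2" "0 < \<omega>"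
      and AU: "A * U = U * (\<omega> \<cdot>\<^sub>m rot)"
      using antisymmetric_rotation_plane[OF less.prems] by auto
    have n2: "2 \<le> n" by (rule orthonormal_dim_le[OF U(1,2)])
    hence nn: "2 + (n - 2) = n" by simp
    obtain P where P: "P \<in> carrier_mat n (n - 2)" "P\<^sup>T * P = 1\<^sub>m (n - 2)" "P\<^sup>T * U = 0\<^sub>m (n - 2) 2"
      using orthonormal_completion[OF U(1,2)] by blast
    define A' where "A' = P\<^sup>T * A * P"
    have A': "antisymmetric_mat (n - 2) A'" "A' \<in> carrier_mat (n - 2) (n - 2)"
      using antisymmetric_congruence[OF A P(1)] by (auto simp: A'_def antisymmetric_mat_def)
    have rotc: "\<omega> \<cdot>\<^sub>m rot \<in> carrier_mat 2 2" using rot_carrier by simp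
    \<comment> \<open>Invariance of the plane, to be used twice: \<open>X = P\<close> gives 0 by
      orthogonality, \<open>X = U\<close> gives the rotation itself.\<close>
    have XAU: "X\<^sup>T * A * U = X\<^sup>T * U * (\<omega> \<cdot>\<^sub>m rot)" if "X \<in> carrier_mat n a" for X a
    proof -
      have "X\<^sup>T * A * U = X\<^sup>T * (A * U)" using that AA U by (intro assoc_mult_mat) auto
      also have "\<dots> = X\<^sup>T * U * (\<omega> \<cdot>\<^sub>m rot)"
        unfolding AU using that U rotc by (intro assoc_mult_mat[symmetric]) auto
      finally show ?thesis .
    qed
    have PAU: "P\<^sup>T * A * U = 0\<^sub>m (n - 2) 2" using XAU[OF P(1)] by (simp add: P(3) left_mult_zero_mat[OF rotc])
    have UAU: "U\<^sup>T * A * U = \<omega> \<cdot>\<^sub>m rot" using XAU[OF U(1)] by (simp add: U(2) left_mult_one_mat[OF rotc])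
    have "U\<^sup>T * A * P = - (P\<^sup>T * A * U)\<^sup>T"
      using antisymmetric_congruence_transpose[OF A P(1) U(1)] by simp
    hence UAP: "U\<^sup>T * A * P = 0\<^sub>m 2 (n - 2)" unfolding PAU by (auto intro!: eq_matI)
    \<comment> \<open>In the orthonormal basis \<open>hcat U P\<close> the matrix is block diagonal,
      so \<open>det A'\<close> is a factor of a nonzero determinant.\<close>
    have "det A' \<noteq> 0"
    proof -
      let ?V = "hcat U P"
      have V: "?V \<in> carrier_mat n n" using hcat_carrier[OF U(1) P(1)] unfolding nn .
      have "?V\<^sup>T * ?V = 1\<^sub>m n"
        using hcat_mult_orthonormal[of U n 2 "1\<^sub>m 2" P "n - 2" "1\<^sub>m (n - 2)", unfolded nn] U P
        by simp
      hence "det (?V\<^sup>T) * det ?V = 1" using V det_mult[of "?V\<^sup>T" n ?V] by simp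
      hence "det (?V\<^sup>T * A * ?V) \<noteq> 0"
        using V AA less.prems(2) by (auto simp: det_mult[of _ n])
      moreover have "?V\<^sup>T * A * ?V = four_block_mat (\<omega> \<cdot>\<^sub>m rot) (0\<^sub>m 2 (n - 2)) (0\<^sub>m (n - 2) 2) A'"
        using AA U P by (simp add: congruence_hcat[of A n U 2 P "n - 2"] UAU UAP PAU A'_def)
      moreover have "det \<dots> = det (\<omega> \<cdot>\<^sub>m rot) * det A'"
        using rotc A' by (intro det_four_block_mat_lower_left_zero) auto
      ultimately show ?thesis by auto
    qed
    then obtain Q' \<mu>' where even: "even (n - 2)"
      and Q': "Q' \<in> carrier_mat (n - 2) (n - 2)" "Q'\<^sup>T * Q' = 1\<^sub>m (n - 2)" "\<forall>l. 0 < \<mu>' l"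
        "Q'\<^sup>T * A' * Q' = pfaffian_block (n - 2) \<mu>'"
      using less.IH[of "n - 2" A'] A' False by auto
    \<comment> \<open>The identity factor only brings \<open>Q\<close> into the shape required by
      \<open>congruence_hcat_mult\<close> and \<open>hcat_mult_orthonormal\<close>.\<close>
    define Q where "Q = hcat (U * 1\<^sub>m 2) (P * Q')"
    define \<mu> where "\<mu> = (\<lambda>l. case l of 0 \<Rightarrow> \<omega> | Suc l \<Rightarrow> \<mu>' l)"
    have "Q \<in> carrier_mat n n"
      unfolding Q_def using hcat_carrier[of "U * 1\<^sub>m 2" n 2 "P * Q'" "n - 2", unfolded nn] U P Q'
      by simp
    moreover have "Q\<^sup>T * Q = 1\<^sub>m n"
      using hcat_mult_orthonormal[of U n 2 "1\<^sub>m 2" P "n - 2" Q', unfolded nn] U P Q'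
      by (simp add: Q_def)
    moreover have "\<forall>l. 0 < \<mu> l" using Q' U by (auto simp: \<mu>_def split: nat.split)
    moreover have "Q\<^sup>T * A * Q = pfaffian_block n \<mu>"
    proof -
      have "Q\<^sup>T * A * Q = four_block_mat ((1\<^sub>m 2)\<^sup>T * (U\<^sup>T * A * U) * 1\<^sub>m 2) (0\<^sub>m 2 (n - 2))
          (0\<^sub>m (n - 2) 2) (Q'\<^sup>T * (P\<^sup>T * A * P) * Q')"
        unfolding Q_def using AA U P Q' UAP PAU by (intro congruence_hcat_mult) auto
      also have "\<dots> = pfaffian_block ((n - 2) + 2) \<mu>"
        using rotc Q'(4) even unfolding pfaffian_block_add_2 UAU A'_def[symmetric]
        by (simp add: \<mu>_def left_mult_one_mat[OF rotc] right_mult_one_mat[OF rotc])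
      finally show ?thesis using n2 by (simp only: le_add_diff_inverse2)
    qed
    ultimately have "Q \<in> carrier_mat n n \<and> Q\<^sup>T * Q = 1\<^sub>m n \<and> (\<forall>l. 0 < \<mu> l) \<and>
        Q\<^sup>T * A * Q = pfaffian_block n \<mu>" by blast
    moreover have "even n" using even n2 by simp
    ultimately show ?thesis by blast
  qed
qed

section \<open>The kernel and the normal form in the singular case\<close>

lemma mult_mat_eq_0I:
  assumes A: "A \<in> carrier_mat m n" and N: "N \<in> carrier_mat n d"
    and "\<And>j. j < d \<Longrightarrow> A *\<^sub>v col N j = 0\<^sub>v m"
  shows "A * N = 0\<^sub>m m d"
proof (rule eq_matI)
  fix i j assume ij: "i < dim_row (0\<^sub>m m d)" "j < dim_col (0\<^sub>m m d)"
  hence "(A * N) $$ (i, j) = (A *\<^sub>v col N j) $ i" using A N by simp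
  thus "(A * N) $$ (i, j) = 0\<^sub>m m d $$ (i, j)" using ij assms(3)[of j] by simp
qed (use A N in auto)

lemma orthonormal_kernel_basisD:
  assumes A: "A \<in> carrier_mat n n" and "orthonormal_kernel_basis n d A N"
  shows "N \<in> carrier_mat n d" "N\<^sup>T * N = 1\<^sub>m d" "A * N = 0\<^sub>m n d"
    and "v \<in> carrier_vec n \<Longrightarrow> A *\<^sub>v v = 0\<^sub>v n \<Longrightarrow> \<exists>w \<in> carrier_vec d. v = N *\<^sub>v w"
proof -
  show N: "N \<in> carrier_mat n d" and "N\<^sup>T * N = 1\<^sub>m d"
    using assms by (auto simp: orthonormal_kernel_basis_def)
  have space: "{y \<in> carrier_vec n. \<exists>x \<in> carrier_vec d. N *\<^sub>v x = y} = mat_kernel A"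
    using assms N vec_space.col_space_eq[OF N] by (auto simp: orthonormal_kernel_basis_def)
  show "A * N = 0\<^sub>m n d"
  proof (rule mult_mat_eq_0I[OF A N])
    fix j assume j: "j < d"
    have "N *\<^sub>v unit_vec d j = col N j"
      using j N by (intro eq_vecI) auto
    hence "col N j \<in> mat_kernel A"
      using j N unfolding space[symmetric] by (auto intro!: bexI[of _ "unit_vec d j"])
    thus "A *\<^sub>v col N j = 0\<^sub>v n" using mat_kernelD[OF A] by blast
  qed
  show "\<exists>w \<in> carrier_vec d. v = N *\<^sub>v w" if "v \<in> carrier_vec n" "A *\<^sub>v v = 0\<^sub>v n"
    using mat_kernelI[OF A that] unfolding space[symmetric] by auto
qed

text \<open>The nonsingular case applies to the compression of \<open>A\<close> to the complement of
  the kernel; only the basis of that complement is changed, so the given columns of \<open>N\<close>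
  survive unaltered.\<close>

lemma antisymmetric_normal_form_exists:
  assumes A: "antisymmetric_mat n A" and N0: "orthonormal_kernel_basis n d A N"
  shows "\<exists>Q \<mu>. antisymmetric_normal_form n (n - d) A N Q \<mu>"
proof -
  have AA: "A \<in> carrier_mat n n" using A by (auto simp: antisymmetric_mat_def)
  note N = orthonormal_kernel_basisD[OF AA N0]
  have dn: "d \<le> n" by (rule orthonormal_dim_le[OF N(1,2)])
  define r where "r = n - d"
  have n: "n = r + d" "n - r = d" using dn by (auto simp: r_def)
  obtain P where P: "P \<in> carrier_mat n r" "P\<^sup>T * P = 1\<^sub>m r" "P\<^sup>T * N = 0\<^sub>m r d"
    using orthonormal_completion[OF N(1,2)] by (auto simp: r_def)
  have NP: "N\<^sup>T * P = 0\<^sub>m d r" by (rule transpose_mult_zero[OF P(1) N(1) P(3)])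
  define A' where "A' = P\<^sup>T * A * P"
  have A': "antisymmetric_mat r A'" "A' \<in> carrier_mat r r"
    using antisymmetric_congruence[OF A P(1)] by (auto simp: A'_def antisymmetric_mat_def)
  have XAN: "X\<^sup>T * A * N = 0\<^sub>m a d" if "X \<in> carrier_mat n a" for X a
  proof -
    have "X\<^sup>T * A * N = X\<^sup>T * (A * N)" using that AA N(1) by (intro assoc_mult_mat) auto
    thus ?thesis using that by (simp add: N(3))
  qed
  have "N\<^sup>T * A * P = - (P\<^sup>T * A * N)\<^sup>T"
    using antisymmetric_congruence_transpose[OF A P(1) N(1)] by simp
  hence NAP: "N\<^sup>T * A * P = 0\<^sub>m d r" unfolding XAN[OF P(1)] by (auto intro!: eq_matI)
  let ?V = "hcat P N"
  have V: "?V \<in> carrier_mat n n" using hcat_carrier[OF P(1) N(1)] n by simp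
  have VV: "?V\<^sup>T * ?V = 1\<^sub>m n"
    using hcat_mult_orthonormal[of P n r "1\<^sub>m r" N d "1\<^sub>m d"] N P NP n by simp
  hence VV': "?V * ?V\<^sup>T = 1\<^sub>m n" using V by (intro mat_mult_left_right_inverse[of "?V\<^sup>T"]) auto
  \<comment> \<open>If \<open>A'\<close> kills \<open>v\<close>, then
    \<open>A *\<^sub>v (P *\<^sub>v v)\<close> is orthogonal to the columns of \<open>P\<close> by
    the choice of \<open>v\<close> and to those of \<open>N\<close> by antisymmetry, hence zero. So
    \<open>P *\<^sub>v v\<close> lies in the kernel, that is, in the span of \<open>N\<close>, and
    multiplication by \<open>P\<^sup>T\<close> gives \<open>v = 0\<close>.\<close>
  have "det A' \<noteq> 0"
  proof
    assume "det A' = 0"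
    then obtain v where v: "v \<in> carrier_vec r" "v \<noteq> 0\<^sub>v r" "A' *\<^sub>v v = 0\<^sub>v r"
      using det_0_iff_vec_prod_zero[OF A'(2)] by auto
    have Pv: "P *\<^sub>v v \<in> carrier_vec n" using P v by auto
    have "(N\<^sup>T * A * P) *\<^sub>v v = 0\<^sub>v d" unfolding NAP using v by (simp add: zero_mat_mult_vec)
    hence NAPv: "N\<^sup>T *\<^sub>v (A *\<^sub>v (P *\<^sub>v v)) = 0\<^sub>v d"
      using N(1) AA P v by (simp add: assoc_mult_mat_vec[of _ d n _ r] assoc_mult_mat_vec[of _ d n _ n])
    have PAPv: "P\<^sup>T *\<^sub>v (A *\<^sub>v (P *\<^sub>v v)) = 0\<^sub>v r"
      using v(3) AA P v(1) unfolding A'_def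
      by (simp add: assoc_mult_mat_vec[of _ r n _ r] assoc_mult_mat_vec[of _ r n _ n])
    have "?V\<^sup>T *\<^sub>v (A *\<^sub>v (P *\<^sub>v v)) = 0\<^sub>v n"
    proof (rule eq_vecI)
      fix i assume "i < dim_vec (0\<^sub>v n)"
      hence i: "i < r + d" using n by simp
      have "(?V\<^sup>T *\<^sub>v (A *\<^sub>v (P *\<^sub>v v))) $ i = col ?V i \<bullet> (A *\<^sub>v (P *\<^sub>v v))"
        using i P(1) N(1) by simp
      also have "\<dots> = 0"
        using i arg_cong[OF PAPv, of "\<lambda>x. x $ i"] arg_cong[OF NAPv, of "\<lambda>x. x $ (i - r)"] P N(1)
        by (auto simp: col_hcat[of P n r N d])
      finally show "(?V\<^sup>T *\<^sub>v (A *\<^sub>v (P *\<^sub>v v))) $ i = 0\<^sub>v n $ i" using i n by simp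
    qed (use V in auto)
    hence "?V *\<^sub>v (?V\<^sup>T *\<^sub>v (A *\<^sub>v (P *\<^sub>v v))) = 0\<^sub>v n" using V by (simp add: mult_mat_zero_vec)
    hence "(?V * ?V\<^sup>T) *\<^sub>v (A *\<^sub>v (P *\<^sub>v v)) = 0\<^sub>v n"
      using V AA Pv by (subst assoc_mult_mat_vec[of _ n n _ n]) auto
    hence "A *\<^sub>v (P *\<^sub>v v) = 0\<^sub>v n"
      unfolding VV' using AA Pv by (metis mult_mat_vec_carrier one_mult_mat_vec)
    then obtain w where w: "w \<in> carrier_vec d" "P *\<^sub>v v = N *\<^sub>v w"
      using N(4)[OF Pv] by auto
    have "v = (P\<^sup>T * P) *\<^sub>v v" using P v by simp
    also have "\<dots> = P\<^sup>T *\<^sub>v (N *\<^sub>v w)"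
      unfolding w(2)[symmetric] using P v by (intro assoc_mult_mat_vec) auto
    also have "\<dots> = (P\<^sup>T * N) *\<^sub>v w" using P N w by (intro assoc_mult_mat_vec[symmetric]) auto
    also have "\<dots> = 0\<^sub>v r" using w by (simp add: P(3) zero_mat_mult_vec)
    finally show False using v by simp
  qed
  from antisymmetric_nonsingular_normal_form[OF A'(1) this] obtain Q' \<mu> where even: "even r"
    and Q': "Q' \<in> carrier_mat r r" "Q'\<^sup>T * Q' = 1\<^sub>m r" "\<forall>l. 0 < \<mu> l"
      "Q'\<^sup>T * A' * Q' = pfaffian_block r \<mu>" by blast
  define Q where "Q = hcat (P * Q') (N * 1\<^sub>m d)"
  have "Q \<in> carrier_mat n n"
    using hcat_carrier[of "P * Q'" n r "N * 1\<^sub>m d" d] N(1) P Q' n by (simp add: Q_def)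
  moreover have "Q\<^sup>T * Q = 1\<^sub>m n"
    using hcat_mult_orthonormal[of P n r Q' N d "1\<^sub>m d"] N(1,2) P Q' n NP by (simp add: Q_def)
  moreover have "Q\<^sup>T * A * Q = diag_block_mat [pfaffian_block r \<mu>, 0\<^sub>m d d]"
  proof -
    have "Q\<^sup>T * A * Q = four_block_mat (Q'\<^sup>T * (P\<^sup>T * A * P) * Q') (0\<^sub>m r d) (0\<^sub>m d r)
        ((1\<^sub>m d)\<^sup>T * (N\<^sup>T * A * N) * 1\<^sub>m d)"
      unfolding Q_def using AA N(1) P Q' NAP XAN[OF P(1)] by (intro congruence_hcat_mult) auto
    also have "\<dots> = diag_block_mat [pfaffian_block r \<mu>, 0\<^sub>m d d]"
      using Q'(4) even pfaffian_block_carrier[of r \<mu>] unfolding XAN[OF N(1)] A'_def[symmetric]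
      by (simp add: Let_def)
    finally show ?thesis .
  qed
  moreover have "col Q (r + j) = col N j" if "j < d" for j
    using that P N(1) Q' by (simp add: Q_def col_hcat[of "P * Q'" n r "N" d])
  ultimately have "antisymmetric_normal_form n r A N Q \<mu>"
    using Q'(3) unfolding antisymmetric_normal_form_def n(2) by blast
  thus ?thesis unfolding r_def by blast
qed

section \<open>Inverses and block determinants\<close>

lemma det_nonzero_inverse:
  fixes A :: "'a :: field mat"
  assumes A: "A \<in> carrier_mat n n" and "det A \<noteq> 0"
  shows "\<exists>K \<in> carrier_mat n n. A * K = 1\<^sub>m n \<and> K * A = 1\<^sub>m n"
  using det_non_zero_imp_unit[OF assms, of "()"]
  unfolding Units_def ring_mat_def by auto

lemma invertible_mat_iff_det:
  fixes A :: "'a :: field mat"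
  assumes A: "A \<in> carrier_mat n n"
  shows "invertible_mat A \<longleftrightarrow> det A \<noteq> 0"
proof
  assume "invertible_mat A"
  then obtain K where K: "A * K = 1\<^sub>m n" "K * A = 1\<^sub>m (dim_row K)"
    using A by (auto simp: invertible_mat_def inverts_mat_def)
  have "dim_row K = n"
    using K(2) A by (metis carrier_matD(2) index_mult_mat(3) index_one_mat(3))
  moreover have "dim_col K = n"
    using K(1) by (metis index_mult_mat(3) index_one_mat(3))
  ultimately have "K \<in> carrier_mat n n" by auto
  thus "det A \<noteq> 0" using K(1) det_mult[OF A, of K] by auto
next
  assume "det A \<noteq> 0"
  from det_nonzero_inverse[OF A this] show "invertible_mat A"
    using A by (auto simp: invertible_mat_def inverts_mat_def)
qed

text \<open>Block column elimination: the unipotent factor with corner \<open>- (K * X)\<close>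
  clears the upper right block, because \<open>J * (K * X) = X\<close>.\<close>

lemma det_four_block_mat_Schur:
  fixes J :: "'a :: field mat"
  assumes J: "J \<in> carrier_mat a a" and K: "K \<in> carrier_mat a a" and JK: "J * K = 1\<^sub>m a"
    and X: "X \<in> carrier_mat a b" and Y: "Y \<in> carrier_mat b a" and Z: "Z \<in> carrier_mat b b"
  shows "det (four_block_mat J X Y Z) = det J * det (Z - Y * K * X)"
proof -
  let ?F = "four_block_mat J X Y Z"
  let ?E = "four_block_mat (1\<^sub>m a) (- (K * X)) (0\<^sub>m b a) (1\<^sub>m b)"
  have KX: "K * X \<in> carrier_mat a b" using K X by simp
  have "J * (K * X) = X"
    using assoc_mult_mat[OF J K X] X by (simp add: JK)
  hence "?F * ?E = four_block_mat J (- X + X) Y (- (Y * (K * X)) + Z)"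
    using J K X Y Z KX by (subst mult_four_block_mat[of _ a a _ b _ b _ _ a _ b]) auto
  moreover have "- X + X = 0\<^sub>m a b" using X by simp
  moreover have "- (Y * (K * X)) + Z = Z - Y * K * X"
    using K X Y Z by (intro eq_matI) (auto simp: assoc_mult_mat[of _ b a _ a _ b])
  ultimately have FE: "?F * ?E = four_block_mat J (0\<^sub>m a b) Y (Z - Y * K * X)" by simp
  have "det (?F * ?E) = det ?F * det ?E"
    using J Z by (intro det_mult[of _ "a + b"]) auto
  moreover have "det ?E = 1"
    using KX by (subst det_four_block_mat_lower_left_zero[of _ a _ b]) auto
  moreover have "det (?F * ?E) = det J * det (Z - Y * K * X)"
    unfolding FE using J K X Y Z
    by (intro det_four_block_mat_upper_right_zero[of _ a _ b]) (auto intro!: minus_carrier_mat)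
  ultimately show ?thesis by simp
qed

text \<open>In the factorisation \<open>?L * ?S\<close> the block \<open>M\<close> sits below the
  diagonal of a block triangular matrix and does not affect its determinant. The antidiagonal factor
  contributes \<open>det \<Gamma>\<close> without a sign, since the minus in
  \<open>- \<Gamma>\<^sup>T\<close> offsets the exchange of the blocks.\<close>

lemma det_reduced_mat_square:
  assumes G: "\<Gamma> \<in> carrier_mat d d" and M: "M \<in> carrier_mat d d"
  shows "det (reduced_mat d \<Gamma> M) = (det \<Gamma>)\<^sup>2"
proof -
  let ?L = "four_block_mat \<Gamma> (0\<^sub>m d d) M (1\<^sub>m d)"
  let ?S = "four_block_mat (0\<^sub>m d d) (1\<^sub>m d) (- \<Gamma>\<^sup>T) (0\<^sub>m d d)"
  have "?L * ?S = reduced_mat d \<Gamma> M"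
    using G M unfolding reduced_mat_def
    by (subst mult_four_block_mat[of _ d d _ d _ d _ _ d _ d])
       (auto intro!: cong_four_block_mat)
  moreover have "det (?L * ?S) = det ?L * det ?S"
    using G by (intro det_mult[of _ "d + d"]) auto
  moreover have "det ?L = det \<Gamma>"
    using G M by (subst det_four_block_mat_upper_right_zero[of _ d _ d]) auto
  moreover have "det ?S = det \<Gamma>"
  proof -
    have "det ?S = det (0\<^sub>m d d * 0\<^sub>m d d - 1\<^sub>m d * (- \<Gamma>\<^sup>T))"
      using G by (intro det_four_block_mat[of _ d]) auto
    also have "0\<^sub>m d d * 0\<^sub>m d d - 1\<^sub>m d * (- \<Gamma>\<^sup>T) = \<Gamma>\<^sup>T"
      using G by (intro eq_matI) auto
    finally show ?thesis using det_transpose[OF G] by simp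
  qed
  ultimately show ?thesis by (simp add: power2_eq_square)
qed

section \<open>The determinant of the bordered matrix\<close>

text \<open>Counting rows on both sides of the block form gives
  \<open>2 * (r div 2) + d = r + d\<close>, hence evenness. The matrix \<open>P\<close> consists of
  the first \<open>r\<close> columns of \<open>Q\<close>.\<close>

lemma antisymmetric_normal_formD:
  assumes A: "A \<in> carrier_mat n n" and N: "N \<in> carrier_mat n d" and n: "n = r + d"
    and nf: "antisymmetric_normal_form n r A N Q \<mu>"
  shows "even r"
    and "\<exists>P \<in> carrier_mat n r. Q = hcat P N"
    and "Q\<^sup>T * A * Q = four_block_mat (pfaffian_block r \<mu>) (0\<^sub>m r d) (0\<^sub>m d r) (0\<^sub>m d d)"
proof -
  have Q: "Q \<in> carrier_mat n n" and nd: "n - r = d"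
    and QAQ: "Q\<^sup>T * A * Q = diag_block_mat [pfaffian_block r \<mu>, 0\<^sub>m d d]"
    and col: "\<And>j. j < d \<Longrightarrow> col Q (r + j) = col N j"
    using nf n by (auto simp: antisymmetric_normal_form_def)
  have "dim_row (Q\<^sup>T * A * Q) = 2 * (r div 2) + d"
    unfolding QAQ using pfaffian_block_carrier[of r \<mu>] by (auto simp: dim_diag_block_mat)
  hence r: "2 * (r div 2) = r" using Q n by simp
  thus "even r" by presburger
  show "Q\<^sup>T * A * Q = four_block_mat (pfaffian_block r \<mu>) (0\<^sub>m r d) (0\<^sub>m d r) (0\<^sub>m d d)"
    unfolding QAQ using pfaffian_block_carrier[of r \<mu>] r by (auto simp: Let_def)
  define P where "P = mat n r (\<lambda>(i, j). Q $$ (i, j))"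
  have P: "P \<in> carrier_mat n r" by (simp add: P_def)
  have "Q = hcat P N"
  proof (rule eq_matI)
    fix i j assume "i < dim_row (hcat P N)" "j < dim_col (hcat P N)"
    hence ij: "i < n" "j < r + d" using P N by auto
    show "Q $$ (i, j) = hcat P N $$ (i, j)"
    proof (cases "j < r")
      case True
      thus ?thesis using ij P N by (simp add: index_hcat[of P n r N d]) (simp add: P_def)
    next
      case False
      hence "Q $$ (i, j) = col Q (r + (j - r)) $ i" using ij Q n by simp
      also have "\<dots> = N $$ (i, j - r)" using ij False N by (subst col) auto
      finally show ?thesis using ij P N False by (simp add: index_hcat[of P n r N d])
    qed
  qed (use Q P N n in auto)
  with P show "\<exists>P \<in> carrier_mat n r. Q = hcat P N" by blast
qed

text \<open>Transposing \<open>J * K = 1\<close> gives \<open>- (K\<^sup>T * J) = 1\<close>;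
  multiplying by \<open>K\<close> on the right turns this into
  \<open>K = - K\<^sup>T\<close>.\<close>

lemma antisymmetric_inverse:
  assumes J: "antisymmetric_mat n J" and K: "K \<in> carrier_mat n n" and JK: "J * K = 1\<^sub>m n"
  shows "antisymmetric_mat n K"
proof -
  have J': "J \<in> carrier_mat n n" "J\<^sup>T = - J" using J by (auto simp: antisymmetric_mat_def)
  have "K\<^sup>T * J\<^sup>T = 1\<^sub>m n" using transpose_mult[OF J'(1) K] by (simp add: JK)
  hence KJ: "- (K\<^sup>T * J) = 1\<^sub>m n" using J' K by simp
  have "K = - (K\<^sup>T * J) * K" using K by (simp add: KJ)
  also have "\<dots> = - (K\<^sup>T * (J * K))"
    using J' K by (simp add: assoc_mult_mat[of _ n n _ n _ n])
  also have "\<dots> = - K\<^sup>T" using K by (simp add: JK)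
  finally have "K = - K\<^sup>T" .
  hence "- K = K\<^sup>T" by (metis uminus_uminus_mat)
  thus ?thesis using K by (simp add: antisymmetric_mat_def)
qed

text \<open>An arbitrary normal form is the starting point, and the witness \<open>M\<close> depends
  on it through \<open>P\<close> and the inverse \<open>K\<close> of the block.\<close>

lemma det_bordered_mat:
  assumes A: "antisymmetric_mat n A" and N: "N \<in> carrier_mat n d" and n: "n = r + d"
    and B: "B \<in> carrier_mat n k" and nf: "antisymmetric_normal_form n r A N Q \<mu>"
  shows "\<exists>M. antisymmetric_mat k M \<and>
    det (bordered_mat k A B) = det (pfaffian_block r \<mu>) * det (reduced_mat d (N\<^sup>T * B) M)"
proof -
  have AA: "A \<in> carrier_mat n n" using A by (auto simp: antisymmetric_mat_def)
  note nfD = antisymmetric_normal_formD[OF AA N n nf]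
  have Q: "Q \<in> carrier_mat n n" "Q\<^sup>T * Q = 1\<^sub>m n" and \<mu>: "\<forall>l < r div 2. 0 < \<mu> l"
    using nf by (auto simp: antisymmetric_normal_form_def)
  obtain P where P: "P \<in> carrier_mat n r" and QPN: "Q = hcat P N" using nfD(2) by blast
  define J where "J = pfaffian_block r \<mu>"
  have J: "J \<in> carrier_mat r r"
    using pfaffian_block_carrier[of r \<mu>] nfD(1) by (simp add: J_def)
  have QAQ: "Q\<^sup>T * A * Q = four_block_mat J (0\<^sub>m r d) (0\<^sub>m d r) (0\<^sub>m d d)"
    using nfD(3) by (simp add: J_def)
  have "Q\<^sup>T * A * Q = four_block_mat (P\<^sup>T * A * P) (P\<^sup>T * A * N) (N\<^sup>T * A * P) (N\<^sup>T * A * N)"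
    unfolding QPN by (rule congruence_hcat[OF AA P N])
  hence blocks: "four_block_mat J (0\<^sub>m r d) (0\<^sub>m d r) (0\<^sub>m d d) =
      four_block_mat (P\<^sup>T * A * P) (P\<^sup>T * A * N) (N\<^sup>T * A * P) (N\<^sup>T * A * N)"
    unfolding QAQ .
  \<comment> \<open>Recognising \<open>J\<close> as a compression of \<open>A\<close> yields its
    antisymmetry without inspecting the blocks; this passes to \<open>K\<close> and from there to
    \<open>M\<close>.\<close>
  have "J $$ (i, j) = (P\<^sup>T * A * P) $$ (i, j)" if "i < r" "j < r" for i j
    using arg_cong[OF blocks, of "\<lambda>F. F $$ (i, j)"] that J P N AA by (simp del: index_mult_mat(1))
  hence "J = P\<^sup>T * A * P" using J P by (intro eq_matI) auto
  hence Janti: "antisymmetric_mat r J" using antisymmetric_congruence[OF A P] by simp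
  have "det J \<noteq> 0" using \<mu> by (auto simp: J_def det_pfaffian_block)
  then obtain K where K: "K \<in> carrier_mat r r" "J * K = 1\<^sub>m r"
    using det_nonzero_inverse[OF J] by blast
  have Kanti: "antisymmetric_mat r K" by (rule antisymmetric_inverse[OF Janti K])
  define \<Gamma> where "\<Gamma> = N\<^sup>T * B"
  define B1 where "B1 = P\<^sup>T * B"
  define M where "M = B1\<^sup>T * K * B1"
  have G: "\<Gamma> \<in> carrier_mat d k" using N B by (simp add: \<Gamma>_def)
  have B1: "B1 \<in> carrier_mat r k" using P B by (simp add: B1_def)
  have M: "antisymmetric_mat k M" "M \<in> carrier_mat k k"
    using antisymmetric_congruence[OF Kanti B1] by (auto simp: M_def antisymmetric_mat_def)
  have QB: "(Q\<^sup>T * B) $$ (i, j) = (if i < r then B1 $$ (i, j) else \<Gamma> $$ (i - r, j))"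
    if "i < r + d" "j < k" for i j
    using that P N B n unfolding QPN B1_def \<Gamma>_def by (auto simp: col_hcat[of P n r N d])
  let ?F = "bordered_mat k A B"
  let ?U = "four_block_mat Q (0\<^sub>m n k) (0\<^sub>m k n) (1\<^sub>m k)"
  let ?X = "hcat (0\<^sub>m r d) B1"
  have F: "?F \<in> carrier_mat (n + k) (n + k)" using AA by (simp add: bordered_mat_def)
  have U: "?U \<in> carrier_mat (n + k) (n + k)" using Q by simp
  have X: "?X \<in> carrier_mat r (d + k)" using B1 by simp
  have "?U\<^sup>T = four_block_mat Q\<^sup>T (0\<^sub>m n k) (0\<^sub>m k n) (1\<^sub>m k)"
    using Q by (simp add: transpose_four_block_mat[of _ n n _ k _ k])
  moreover have "\<dots> * ?F = four_block_mat (Q\<^sup>T * A) (Q\<^sup>T * B) (- B\<^sup>T) (0\<^sub>m k k)"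
    unfolding bordered_mat_def using Q AA B
    by (subst mult_four_block_mat[of _ n n _ k _ k _ _ n _ k]) auto
  moreover have "\<dots> * ?U = four_block_mat (Q\<^sup>T * A * Q) (Q\<^sup>T * B) (- B\<^sup>T * Q) (0\<^sub>m k k)"
    using Q AA B by (subst mult_four_block_mat[of _ n n _ k _ k _ _ n _ k]) auto
  ultimately have UFU: "?U\<^sup>T * ?F * ?U = four_block_mat (Q\<^sup>T * A * Q) (Q\<^sup>T * B) (- B\<^sup>T * Q) (0\<^sub>m k k)"
    by simp
  have BQ: "- B\<^sup>T * Q = - (Q\<^sup>T * B)\<^sup>T" using Q B by (simp add: transpose_mult[of _ n n _ k])
  \<comment> \<open>The index set has three parts of sizes \<open>r\<close>, \<open>d\<close>,
    \<open>k\<close>. The conjugation brackets them as \<open>(r + d) + k\<close>, whereas the Schur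
    complement of \<open>J\<close> needs \<open>r + (d + k)\<close>.\<close>
  have regroup: "?U\<^sup>T * ?F * ?U = four_block_mat J ?X (- ?X\<^sup>T) (reduced_mat d \<Gamma> (0\<^sub>m k k))" (is "_ = ?G")
    unfolding UFU QAQ BQ
  proof (rule eq_matI)
    fix i j assume "i < dim_row ?G" "j < dim_col ?G"
    hence ij: "i < r + d + k" "j < r + d + k" using J by (auto simp: reduced_mat_def)
    show "four_block_mat (four_block_mat J (0\<^sub>m r d) (0\<^sub>m d r) (0\<^sub>m d d)) (Q\<^sup>T * B)
        (- (Q\<^sup>T * B)\<^sup>T) (0\<^sub>m k k) $$ (i, j) = ?G $$ (i, j)"
      using ij J B1 G Q B n QB[of i "j - (r + d)"] QB[of j "i - (r + d)"]
      by (auto simp: reduced_mat_def index_hcat[of _ r d _ k] simp del: index_mult_mat(1))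
  qed (use J Q B n in \<open>auto simp: reduced_mat_def\<close>)
  \<comment> \<open>The minus in the lower left block turns the subtraction in the Schur complement
    into an addition, and the zero columns of \<open>?X\<close> confine the added term to the
    \<open>k \<times> k\<close> corner.\<close>
  have "- ?X\<^sup>T * K * ?X = - (?X\<^sup>T * K * ?X)"
    using X K by simp
  also have "?X\<^sup>T * K * ?X = four_block_mat (0\<^sub>m d d) (0\<^sub>m d k) (0\<^sub>m k d) M"
    using K B1 by (simp add: congruence_hcat[of K r _ d _ k] M_def)
  finally have "reduced_mat d \<Gamma> (0\<^sub>m k k) - (- ?X\<^sup>T * K * ?X) = reduced_mat d \<Gamma> M"
    using M G by (intro eq_matI) (auto simp: reduced_mat_def)
  moreover have "det (?U\<^sup>T * ?F * ?U) = det J * det (reduced_mat d \<Gamma> (0\<^sub>m k k) - (- ?X\<^sup>T * K * ?X))"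
    unfolding regroup using J K X by (intro det_four_block_mat_Schur[of _ r]) (auto simp: reduced_mat_def)
  \<comment> \<open>The factor \<open>det Q\<close> enters twice, so it does not matter whether it
    is 1 or -1.\<close>
  moreover have "det (?U\<^sup>T * ?F * ?U) = det ?F"
  proof -
    have "det (Q\<^sup>T) * det Q = 1" using Q det_mult[of "Q\<^sup>T" n Q] by simp
    hence "(det Q)\<^sup>2 = 1" using det_transpose[OF Q(1)] by (simp add: power2_eq_square)
    moreover have "det ?U = det Q"
      using Q by (subst det_four_block_mat_lower_left_zero[of _ n _ k]) auto
    moreover have "det (?U\<^sup>T * ?F * ?U) = det ?U * det ?F * det ?U"
      using U F det_transpose[OF U] by (simp add: det_mult[of _ "n + k"])
    ultimately show ?thesis by (simp add: power2_eq_square mult_ac)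
  qed
  ultimately have "det ?F = det J * det (reduced_mat d \<Gamma> M)" by simp
  thus ?thesis using M unfolding J_def \<Gamma>_def by blast
qed

section \<open>Full row rank of the coupling block\<close>

lemma rank_eq_dim_row:
  fixes A :: "'a :: field mat"
  assumes A: "A \<in> carrier_mat n k" and onto: "\<And>y. y \<in> carrier_vec n \<Longrightarrow> \<exists>x \<in> carrier_vec k. A *\<^sub>v x = y"
  shows "vec_space.rank n A = n"
proof -
  interpret vec_space "TYPE('a)" n .
  have "span (set (cols A)) = carrier_vec n"
    using onto A col_space_eq[OF A] by (auto simp: col_space_def)
  moreover have "vs (carrier_vec n) = V" by (simp add: module_vec_def)
  ultimately show ?thesis unfolding rank_def using dim_is_n by (simp only:)
qed

lemma rank_of_det_reduced_mat:
  assumes G: "\<Gamma> \<in> carrier_mat d k" and M: "M \<in> carrier_mat k k" and "det (reduced_mat d \<Gamma> M) \<noteq> 0"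
  shows "vec_space.rank d \<Gamma> = d"
proof (rule rank_eq_dim_row[OF G])
  fix y :: "real vec" assume y: "y \<in> carrier_vec d"
  let ?R = "reduced_mat d \<Gamma> M"
  have R: "?R \<in> carrier_mat (d + k) (d + k)" using M by (simp add: reduced_mat_def)
  obtain S where S: "S \<in> carrier_mat (d + k) (d + k)" "?R * S = 1\<^sub>m (d + k)"
    using det_nonzero_inverse[OF R assms(3)] by blast
  \<comment> \<open>Solving \<open>?R *\<^sub>v z = y @\<^sub>v 0\<^sub>v k\<close>, the first block
    row involves only the last \<open>k\<close> entries of \<open>z\<close>, which therefore form a
    preimage of \<open>y\<close> under \<open>\<Gamma>\<close>.\<close>
  define z where "z = S *\<^sub>v (y @\<^sub>v 0\<^sub>v k)"
  have z: "z \<in> carrier_vec (d + k)" using S y by (auto simp: z_def)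
  have split: "z = vec_first z d @\<^sub>v vec_last z k" using z by simp
  have y0: "y @\<^sub>v 0\<^sub>v k \<in> carrier_vec (d + k)" using y by simp
  have "?R *\<^sub>v z = y @\<^sub>v 0\<^sub>v k"
    unfolding z_def assoc_mult_mat_vec[OF R S(1) y0, symmetric] S(2) using y0 by simp
  moreover have "?R *\<^sub>v (vec_first z d @\<^sub>v vec_last z k) =
      (0\<^sub>m d d *\<^sub>v vec_first z d + \<Gamma> *\<^sub>v vec_last z k) @\<^sub>v (- \<Gamma>\<^sup>T *\<^sub>v vec_first z d + M *\<^sub>v vec_last z k)"
    unfolding reduced_mat_def using G M by (intro four_block_mat_mult_vec[of _ d d _ k _ k]) auto
  ultimately have "(0\<^sub>m d d *\<^sub>v vec_first z d + \<Gamma> *\<^sub>v vec_last z k) @\<^sub>v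
      (- \<Gamma>\<^sup>T *\<^sub>v vec_first z d + M *\<^sub>v vec_last z k) = y @\<^sub>v 0\<^sub>v k"
    using split by metis
  moreover have "0\<^sub>m d d *\<^sub>v vec_first z d + \<Gamma> *\<^sub>v vec_last z k \<in> carrier_vec d"
    using G by (intro add_carrier_vec) (auto simp: zero_mat_mult_vec[of _ d])
  ultimately have "0\<^sub>m d d *\<^sub>v vec_first z d + \<Gamma> *\<^sub>v vec_last z k = y"
    using append_vec_eq[OF _ y] by blast
  hence "\<Gamma> *\<^sub>v vec_last z k = y"
    using G by (simp add: zero_mat_mult_vec[of _ d])
  thus "\<exists>x \<in> carrier_vec k. \<Gamma> *\<^sub>v x = y" by (intro bexI[of _ "vec_last z k"]) auto
qed

(* In the final equivalence the hypothesis k \<le> d cannot be dropped: for n = k = 3, r = 2, d = 1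
   and B the identity matrix, the bordered matrix is invertible although k \<noteq> d. *)

theorem lemma1:
  fixes f0 B N :: "real mat" and n r d k :: nat
  assumes "antisymmetric_mat n f0"
    and "vec_space.rank n f0 = r"
    and "d = kernel_dim f0" and "r = n - d" and "d \<ge> 1"
    and "B \<in> carrier_mat n k"
    and "orthonormal_kernel_basis n d f0 N"
  defines "\<Gamma> \<equiv> N\<^sup>T * B"
    and "fm \<equiv> bordered_mat k f0 B"
  shows
    "(\<exists>Q \<mu>. antisymmetric_normal_form n r f0 N Q \<mu>) \<and>
     (\<forall>Q \<mu>. antisymmetric_normal_form n r f0 N Q \<mu> \<longrightarrow>
        (\<exists>M. antisymmetric_mat k M \<and>
             det fm = det (pfaffian_block r \<mu>) * det (reduced_mat d \<Gamma> M)) \<and>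
        (k = d \<longrightarrow> det fm = (\<Prod>l<r div 2. (\<mu> l)\<^sup>2) * (det \<Gamma>)\<^sup>2)) \<and>
     (invertible_mat fm \<longleftrightarrow> vec_space.rank (n + k) fm = n + k) \<and>
     (k = d \<longrightarrow> (det \<Gamma> \<noteq> 0 \<longleftrightarrow> vec_space.rank d \<Gamma> = d)) \<and>
     (invertible_mat fm \<longrightarrow> vec_space.rank d \<Gamma> = d) \<and>
     (k \<le> d \<longrightarrow> (invertible_mat fm \<longleftrightarrow> k = d \<and> det \<Gamma> \<noteq> 0))"
proof -
  have A: "f0 \<in> carrier_mat n n" using assms(1) by (auto simp: antisymmetric_mat_def)
  note N = orthonormal_kernel_basisD[OF A assms(7)]
  have n: "n = r + d" using orthonormal_dim_le[OF N(1,2)] assms(4) by simp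
  have G: "\<Gamma> \<in> carrier_mat d k" using N(1) assms(6) by (simp add: \<Gamma>_def)
  have F: "fm \<in> carrier_mat (n + k) (n + k)" using A by (simp add: fm_def bordered_mat_def)
  \<comment> \<open>The statements about invertibility mention no normal form, so one is fixed here
    to make the determinant formula available for them.\<close>
  obtain Q \<mu> where nf: "antisymmetric_normal_form n r f0 N Q \<mu>"
    using antisymmetric_normal_form_exists[OF assms(1,7)] assms(4) by auto
  have detF: "\<exists>M. antisymmetric_mat k M \<and>
      det fm = det (pfaffian_block r \<mu>) * det (reduced_mat d \<Gamma> M)"
    if "antisymmetric_normal_form n r f0 N Q \<mu>" for Q \<mu>
    unfolding fm_def \<Gamma>_def using det_bordered_mat[OF assms(1) N(1) n assms(6) that] .
  have detF': "det fm = (\<Prod>l<r div 2. (\<mu> l)\<^sup>2) * (det \<Gamma>)\<^sup>2"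
    if "antisymmetric_normal_form n r f0 N Q \<mu>" "k = d" for Q \<mu>
    using detF[OF that(1)] that(2) G
    by (auto simp: det_pfaffian_block det_reduced_mat_square antisymmetric_mat_def)
  have inv: "invertible_mat fm \<longleftrightarrow> det fm \<noteq> 0" by (rule invertible_mat_iff_det[OF F])
  have rankG: "vec_space.rank d \<Gamma> = d" if "det fm \<noteq> 0"
  proof -
    obtain M where "antisymmetric_mat k M" "det (reduced_mat d \<Gamma> M) \<noteq> 0"
      using detF[OF nf] \<open>det fm \<noteq> 0\<close> by auto
    thus ?thesis using rank_of_det_reduced_mat[OF G] by (auto simp: antisymmetric_mat_def)
  qed
  have detG: "det \<Gamma> \<noteq> 0 \<longleftrightarrow> vec_space.rank d \<Gamma> = d" if "k = d"
    using G that by (intro vec_space.det_rank_iff) auto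
  have "invertible_mat fm \<longleftrightarrow> k = d \<and> det \<Gamma> \<noteq> 0" if "k \<le> d"
  proof
    assume "invertible_mat fm"
    hence "vec_space.rank d \<Gamma> = d" using inv rankG by blast
    \<comment> \<open>The rank of \<open>\<Gamma>\<close> is at most its number \<open>k\<close> of
      columns, whence \<open>d \<le> k\<close>.\<close>
    moreover from this have "k = d" using vec_space.rank_le_nc[OF G] \<open>k \<le> d\<close> by simp
    ultimately show "k = d \<and> det \<Gamma> \<noteq> 0" using detG by blast
  next
    assume "k = d \<and> det \<Gamma> \<noteq> 0"
    \<comment> \<open>Keeps the product of the squared factors away from 0, so that only
      \<open>det \<Gamma>\<close> decides.\<close>
    moreover have "\<mu> l \<noteq> 0" if "l < r div 2" for l
      using nf that by (auto simp: antisymmetric_normal_form_def)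
    ultimately show "invertible_mat fm" unfolding inv using detF'[OF nf] by auto
  qed
  thus ?thesis
    using nf detF detF' inv rankG detG vec_space.det_rank_iff[OF F] by blast
qed

end
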